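(* Let $1\le s<\frac32$. For every $\delta>0$ there exists an initial datum $u_0\in H^s(\mathbb{R})$ with $\|u_0\|_{H^s}\le \delta$, a time $T_0$ with $0<T_0<\delta$, and a solution $u\in \mathcal{C}([0,T_0];H^s(\mathbb{R}))$ of the Cauchy problem for the Burgers equation $$\partial_t u+u\,u_x=0,\qquad u(0,x)=u_0(x),\quad x\in\mathbb{R},$$ such that $$\|u(T_0)\|_{H^s}\ge \frac1\delta .$$
   Context: Functions are real-valued. With $\widehat f(\xi)=\int_{\mathbb{R}}e^{-ix\xi}f(x)\,\mathrm{d}x$, the Sobolev norm is $\|f\|_{H^s}^2=\int_{\mathbb{R}}(1+\xi^2)^s|\widehat f(\xi)|^2\,\mathrm{d}\xi$. $\mathcal{C}(I;X)$ denotes the continuous functions on the interval $I$ with values in the Banach space $X$. A solution $u\in\mathcal{C}([0,T_0];H^s)$ (with $s\ge 1$) satisfies the equation in the sense of distributions on $(0,T_0)\times\mathbb{R}$ (with $u u_x=\frac12\partial_x(u^2)$, a well-defined element of $L^2(\mathbb{R})$ at each time), and $u(0)=u_0$. *)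

theory Defs
  imports "HOL-Analysis.Analysis"
begin

text \<open>
  Elements of \<open>L\<^sup>2\<close> and \<open>H\<^sup>s\<close> are represented by Borel functions; functions agreeing almost
  everywhere represent the same element.
\<close>

definition square_integrable :: "(real \<Rightarrow> 'a::{banach, second_countable_topology}) \<Rightarrow> bool" where
  "square_integrable f \<longleftrightarrow>
     f \<in> borel_measurable lborel \<and> integrable lborel (\<lambda>x. (norm (f x))\<^sup>2)"

text \<open>
  A function in \<open>L\<^sup>2\<close> need not be integrable, so its Fourier transform is the \<open>L\<^sup>2\<close> limit of the
  Fourier integrals over \<open>[-R, R]\<close> as \<open>R\<close> tends to infinity. The nonnegative integral is used for
  the \<open>L\<^sup>2\<close> distance because the Bochner integral of a non-integrable function is \<open>0\<close>.
\<close>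

definition has_fourier_transform :: "(real \<Rightarrow> real) \<Rightarrow> (real \<Rightarrow> complex) \<Rightarrow> bool" where
  "has_fourier_transform f g \<longleftrightarrow>
     square_integrable f \<and> square_integrable g \<and>
     ((\<lambda>R. \<integral>\<^sup>+ \<xi>. ennreal ((norm (g \<xi> -
          (LBINT x:{-R..R}. exp (- (\<i> * complex_of_real (x * \<xi>))) * complex_of_real (f x))))\<^sup>2)
        \<partial>lborel) \<longlongrightarrow> 0) at_top"

definition fourier_transform :: "(real \<Rightarrow> real) \<Rightarrow> real \<Rightarrow> complex" where
  "fourier_transform f = (SOME g. has_fourier_transform f g)"

text \<open>The following definition of \<open>H\<^sup>s\<close> is meant for \<open>s \<ge> 0\<close>, where \<open>H\<^sup>s\<close> is contained in \<open>L\<^sup>2\<close>.\<close>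

definition sobolev_space :: "real \<Rightarrow> (real \<Rightarrow> real) set" where
  "sobolev_space s = {f. \<exists>g. has_fourier_transform f g \<and>
     integrable lborel (\<lambda>\<xi>. (1 + \<xi>\<^sup>2) powr s * (norm (g \<xi>))\<^sup>2)}"

definition sobolev_norm :: "real \<Rightarrow> (real \<Rightarrow> real) \<Rightarrow> real" where
  "sobolev_norm s f = sqrt (LBINT \<xi>. (1 + \<xi>\<^sup>2) powr s * (norm (fourier_transform f \<xi>))\<^sup>2)"

definition continuous_into_sobolev :: "real \<Rightarrow> real set \<Rightarrow> (real \<Rightarrow> real \<Rightarrow> real) \<Rightarrow> bool" where
  "continuous_into_sobolev s I u \<longleftrightarrow>
     (\<forall>t\<in>I. u t \<in> sobolev_space s) \<and>
     (\<forall>t\<in>I. ((\<lambda>\<tau>. sobolev_norm s (\<lambda>x. u \<tau> x - u t x)) \<longlongrightarrow> 0) (at t within I))"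

definition partial_t :: "(real \<times> real \<Rightarrow> real) \<Rightarrow> real \<times> real \<Rightarrow> real" where
  "partial_t \<phi> = (\<lambda>(t, x). deriv (\<lambda>\<tau>. \<phi> (\<tau>, x)) t)"

definition partial_x :: "(real \<times> real \<Rightarrow> real) \<Rightarrow> real \<times> real \<Rightarrow> real" where
  "partial_x \<phi> = (\<lambda>(t, x). deriv (\<lambda>y. \<phi> (t, y)) x)"

fun k_times_cont_diff :: "nat \<Rightarrow> (real \<times> real \<Rightarrow> real) \<Rightarrow> bool" where
  "k_times_cont_diff 0 \<phi> \<longleftrightarrow> continuous_on UNIV \<phi>"
| "k_times_cont_diff (Suc k) \<phi> \<longleftrightarrow>
     continuous_on UNIV \<phi> \<and>
     (\<forall>t x. (\<lambda>\<tau>. \<phi> (\<tau>, x)) differentiable (at t) \<and> (\<lambda>y. \<phi> (t, y)) differentiable (at x)) \<and>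
     k_times_cont_diff k (partial_t \<phi>) \<and> k_times_cont_diff k (partial_x \<phi>)"

text \<open>
  Test functions on an open set \<open>\<Omega>\<close>, extended by zero to the whole plane.
\<close>

definition test_functions :: "(real \<times> real) set \<Rightarrow> (real \<times> real \<Rightarrow> real) set" where
  "test_functions \<Omega> = {\<phi>. (\<forall>k. k_times_cont_diff k \<phi>) \<and>
     compact (closure {p. \<phi> p \<noteq> 0}) \<and> closure {p. \<phi> p \<noteq> 0} \<subseteq> \<Omega>}"

text \<open>
  The equation \<open>\<partial>\<^sub>t u + \<partial>\<^sub>x (u\<^sup>2 / 2) = 0\<close> in the sense of distributions on \<open>(0, T) \<times> \<real>\<close>. The
  integral is iterated, so that it does not depend on the representatives chosen for the
  elements \<open>u t\<close>, which need not be jointly measurable in \<open>(t, x)\<close>; for \<open>u\<close> continuous in time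
  with values in \<open>L\<^sup>2\<close> the inner integral exists and is continuous in \<open>t\<close>.
\<close>

definition burgers_distributional :: "real \<Rightarrow> (real \<Rightarrow> real \<Rightarrow> real) \<Rightarrow> bool" where
  "burgers_distributional T u \<longleftrightarrow>
     (\<forall>\<phi> \<in> test_functions ({0<..<T} \<times> UNIV).
        (LBINT t:{0<..<T}. (LBINT x. u t x * partial_t \<phi> (t, x)
            + (u t x)\<^sup>2 / 2 * partial_x \<phi> (t, x))) = 0)"

definition burgers_solution ::
    "real \<Rightarrow> real \<Rightarrow> (real \<Rightarrow> real) \<Rightarrow> (real \<Rightarrow> real \<Rightarrow> real) \<Rightarrow> bool" where
  "burgers_solution s T u0 u \<longleftrightarrow>
     continuous_into_sobolev s {0..T} u \<and>
     burgers_distributional T u \<and>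
     (AE x in lborel. u 0 x = u0 x)"

end

theory Submission imports Defs begin

text \<open>
  A tent of height \<open>h\<close> supported on \<open>[-b, b]\<close> with its peak at \<open>0\<close> evolves under the Burgers flow into
  the tent with the same support and its peak at \<open>h t\<close>, as long as \<open>h t < b\<close>. The Fourier transform of
  a tent is explicit and \<open>O((1 + \<xi>\<^sup>2)\<^sup>-\<^sup>1)\<close>, so tents lie in \<open>H\<^sup>s\<close> for \<open>s < 3/2\<close>, and dominated convergence
  applies to their norms. Fix the breaking time \<open>b / h = \<delta>\<close>: the \<open>H\<^sup>s\<close> norm of the initial tent tends to
  \<open>0\<close> with \<open>b\<close>. As the peak \<open>p\<close> approaches \<open>b\<close>, the squared \<open>H\<^sup>s\<close> norm is at least a constant times
  \<open>h\<^sup>2 / (b - p)\<close>, because of the frequencies of order \<open>1 / (b - p)\<close>.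
\<close>

section \<open>The Fourier transform\<close>

lemma norm_diff_square_le:
  fixes a b :: "'a::real_normed_vector"
  shows "(norm (a - b))\<^sup>2 \<le> 2 * (norm a)\<^sup>2 + 2 * (norm b)\<^sup>2"
proof -
  have "(norm (a - b))\<^sup>2 \<le> (norm a + norm b)\<^sup>2"
    by (intro power_mono norm_triangle_ineq4) auto
  also have "\<dots> \<le> 2 * (norm a)\<^sup>2 + 2 * (norm b)\<^sup>2"
    using sum_squares_bound[of "norm a" "norm b"] by (simp add: power2_sum)
  finally show ?thesis .
qed

lemma nn_integral_norm_diff_square_le:
  fixes f g :: "'a \<Rightarrow> 'b::{real_normed_vector, second_countable_topology}"
  assumes [measurable]: "f \<in> borel_measurable M" "g \<in> borel_measurable M"
  shows "(\<integral>\<^sup>+ x. ennreal ((norm (f x - g x))\<^sup>2) \<partial>M)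
    \<le> 2 * (\<integral>\<^sup>+ x. ennreal ((norm (f x))\<^sup>2) \<partial>M) + 2 * (\<integral>\<^sup>+ x. ennreal ((norm (g x))\<^sup>2) \<partial>M)"
proof -
  have "ennreal ((norm (f x - g x))\<^sup>2) \<le> 2 * ennreal ((norm (f x))\<^sup>2) + 2 * ennreal ((norm (g x))\<^sup>2)" for x
    using norm_diff_square_le[of "f x" "g x", THEN ennreal_leI] by (simp add: ennreal_mult ennreal_plus)
  then have "(\<integral>\<^sup>+ x. ennreal ((norm (f x - g x))\<^sup>2) \<partial>M)
      \<le> (\<integral>\<^sup>+ x. 2 * ennreal ((norm (f x))\<^sup>2) + 2 * ennreal ((norm (g x))\<^sup>2) \<partial>M)"
    by (rule nn_integral_mono)
  then show ?thesis by (simp add: nn_integral_add nn_integral_cmult)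
qed

lemma square_integrable_diff:
  assumes f: "square_integrable f" and g: "square_integrable g"
  shows "square_integrable (\<lambda>x. f x - g x)"
proof -
  have [measurable]: "f \<in> borel_measurable borel" "g \<in> borel_measurable borel"
    using assms by (auto simp: square_integrable_def)
  have "integrable lborel (\<lambda>x. 2 * (norm (f x))\<^sup>2 + 2 * (norm (g x))\<^sup>2)"
    using f g by (auto simp: square_integrable_def)
  then have "integrable lborel (\<lambda>x. (norm (f x - g x))\<^sup>2)"
    by (rule Bochner_Integration.integrable_bound) (auto simp: norm_diff_square_le)
  then show ?thesis by (simp add: square_integrable_def)
qed

lemma square_integrable_compact_support:
  fixes f :: "real \<Rightarrow> 'a::{banach, second_countable_topology}"
  assumes f: "continuous_on UNIV f" and supp: "\<And>x. B < \<bar>x\<bar> \<Longrightarrow> f x = 0"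
  shows "square_integrable f"
proof -
  have "integrable lborel (\<lambda>x. indicator {-B..B} x *\<^sub>R (norm (f x))\<^sup>2)"
    by (intro borel_integrable_compact compact_Icc continuous_intros continuous_on_subset[OF f]) auto
  also have "(\<lambda>x. indicator {-B..B} x *\<^sub>R (norm (f x))\<^sup>2) = (\<lambda>x. (norm (f x))\<^sup>2)"
    using supp by (force simp: indicator_def abs_le_iff fun_eq_iff not_le[symmetric])
  finally show ?thesis
    using borel_measurable_continuous_onI[OF f] by (simp add: square_integrable_def)
qed

definition truncation :: "real \<Rightarrow> (real \<Rightarrow> real) \<Rightarrow> real \<Rightarrow> real" where
  "truncation R f x = indicator {-R..R} x * f x"

lemma integrable_truncation:
  assumes "square_integrable f"
  shows "integrable lborel (truncation R f)"
proof (rule Bochner_Integration.integrable_bound)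
  show "integrable lborel (\<lambda>x. indicator {-R..R} x + (f x)\<^sup>2)"
    using assms by (intro Bochner_Integration.integrable_add integrable_real_indicator)
      (auto simp: square_integrable_def emeasure_lborel_Icc_eq)
  show "truncation R f \<in> borel_measurable lborel"
    using assms unfolding truncation_def[abs_def] square_integrable_def by auto
  have "\<bar>f x\<bar> \<le> 1 + (f x)\<^sup>2" for x
    using sum_squares_bound[of 1 "\<bar>f x\<bar>"] by simp
  then show "AE x in lborel. norm (truncation R f x) \<le> norm (indicator {-R..R} x + (f x)\<^sup>2)"
    by (auto simp: truncation_def indicator_def)
qed

definition fourier_integral :: "(real \<Rightarrow> real) \<Rightarrow> real \<Rightarrow> complex" where
  "fourier_integral f \<xi> = (LBINT x. cis (- (x * \<xi>)) * complex_of_real (f x))"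

lemma borel_measurable_fourier_integral [measurable]:
  assumes [measurable]: "f \<in> borel_measurable borel"
  shows "fourier_integral f \<in> borel_measurable borel"
proof -
  have "fourier_integral f = (\<lambda>\<xi>. LBINT x. exp (\<i> * complex_of_real (- (x * \<xi>))) * complex_of_real (f x))"
    by (rule ext) (simp only: fourier_integral_def cis_conv_exp)
  also have "\<dots> \<in> borel_measurable borel"
    by (intro lborel.borel_measurable_lebesgue_integral) measurable
  finally show ?thesis .
qed

lemma norm_fourier_integral_le: "norm (fourier_integral f \<xi>) \<le> (LBINT x. \<bar>f x\<bar>)"
  unfolding fourier_integral_def
  by (rule order.trans[OF integral_norm_bound]) (simp add: norm_mult)

lemma fourier_integral_diff:
  assumes "integrable lborel f" and "integrable lborel g"
  shows "fourier_integral (\<lambda>x. f x - g x) \<xi> = fourier_integral f \<xi> - fourier_integral g \<xi>"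
proof -
  have "integrable lborel (\<lambda>x. cis (- (x * \<xi>)) * complex_of_real (h x))"
    if "integrable lborel h" for h
    using that
  proof (rule Bochner_Integration.integrable_bound)
    have [measurable]: "(\<lambda>x. cis (- (x * \<xi>))) \<in> borel_measurable borel"
      by (intro borel_measurable_continuous_onI continuous_intros)
    show "(\<lambda>x. cis (- (x * \<xi>)) * complex_of_real (h x)) \<in> borel_measurable lborel"
      using that by measurable
  qed (simp add: norm_mult)
  from this[OF assms(1)] this[OF assms(2)] show ?thesis
    by (simp add: fourier_integral_def right_diff_distrib)
qed

lemma has_fourier_transform_iff:
  "has_fourier_transform f g \<longleftrightarrow> square_integrable f \<and> square_integrable g \<and>
     ((\<lambda>R. \<integral>\<^sup>+ \<xi>. ennreal ((norm (g \<xi> - fourier_integral (truncation R f) \<xi>))\<^sup>2) \<partial>lborel) \<longlongrightarrow> 0) at_top"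
proof -
  have "(LBINT x:{-R..R}. exp (- (\<i> * complex_of_real (x * \<xi>))) * complex_of_real (f x))
      = fourier_integral (truncation R f) \<xi>" for R \<xi>
    unfolding set_lebesgue_integral_def fourier_integral_def truncation_def cis_conv_exp
    by (intro Bochner_Integration.integral_cong) (auto simp: indicator_def)
  then show ?thesis by (simp only: has_fourier_transform_def)
qed

lemma has_fourier_transform_measurable:
  "has_fourier_transform f g \<Longrightarrow> g \<in> borel_measurable borel"
  by (simp add: has_fourier_transform_iff square_integrable_def)

lemma has_fourier_transform_diff:
  assumes f: "has_fourier_transform f f'" and g: "has_fourier_transform g g'"
  shows "has_fourier_transform (\<lambda>x. f x - g x) (\<lambda>\<xi>. f' \<xi> - g' \<xi>)"
proof -
  have sq: "square_integrable f" "square_integrable g"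
    using f g by (auto simp: has_fourier_transform_iff)
  note [measurable] = f[THEN has_fourier_transform_measurable] g[THEN has_fourier_transform_measurable]
  have [measurable]: "truncation R f \<in> borel_measurable borel"
    "truncation R g \<in> borel_measurable borel" for R
    using sq[THEN integrable_truncation] by (auto dest: borel_measurable_integrable)
  define err where "err u u' R \<xi> = u' \<xi> - fourier_integral (truncation R u) \<xi>" for u u' R \<xi>
  define err_L2 where "err_L2 u u' R = (\<integral>\<^sup>+ \<xi>. ennreal ((norm (err u u' R \<xi>))\<^sup>2) \<partial>lborel)" for u u' R
  have "truncation R (\<lambda>x. f x - g x) = (\<lambda>x. truncation R f x - truncation R g x)" for R
    by (simp add: truncation_def fun_eq_iff right_diff_distrib)
  then have err_diff: "err (\<lambda>x. f x - g x) (\<lambda>\<xi>. f' \<xi> - g' \<xi>) R \<xi> = err f f' R \<xi> - err g g' R \<xi>" for R \<xi>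
    by (simp add: err_def fourier_integral_diff[OF sq[THEN integrable_truncation]])
  have [measurable]: "err f f' R \<in> borel_measurable borel" "err g g' R \<in> borel_measurable borel" for R
    unfolding err_def[abs_def] by measurable
  have bound: "err_L2 (\<lambda>x. f x - g x) (\<lambda>\<xi>. f' \<xi> - g' \<xi>) R \<le> 2 * err_L2 f f' R + 2 * err_L2 g g' R" for R
    unfolding err_L2_def err_diff by (intro nn_integral_norm_diff_square_le) simp_all
  have "((\<lambda>R. 2 * err_L2 f f' R + 2 * err_L2 g g' R) \<longlongrightarrow> 2 * 0 + 2 * 0) at_top"
    using f g by (intro tendsto_add ennreal_tendsto_cmult)
      (auto simp: has_fourier_transform_iff err_L2_def err_def)
  then have lim: "((\<lambda>R. 2 * err_L2 f f' R + 2 * err_L2 g g' R) \<longlongrightarrow> 0) at_top" by simp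
  have "(err_L2 (\<lambda>x. f x - g x) (\<lambda>\<xi>. f' \<xi> - g' \<xi>) \<longlongrightarrow> 0) at_top"
    using tendsto_const lim by (rule tendsto_sandwich[rotated 2]) (simp_all add: bound)
  then show ?thesis
    using f g by (simp add: has_fourier_transform_iff square_integrable_diff err_L2_def[abs_def] err_def)
qed

lemma has_fourier_transform_AE_unique:
  assumes g: "has_fourier_transform f g" and g': "has_fourier_transform f g'"
  shows "AE \<xi> in lborel. g \<xi> = g' \<xi>"
proof -
  note [measurable] = g[THEN has_fourier_transform_measurable] g'[THEN has_fourier_transform_measurable]
  have "fourier_integral (truncation R (\<lambda>x. 0)) \<xi> = 0" for R \<xi>
    by (simp add: fourier_integral_def truncation_def)
  then have "(\<integral>\<^sup>+ \<xi>. ennreal ((norm (g \<xi> - g' \<xi>))\<^sup>2) \<partial>lborel) = 0"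
    using has_fourier_transform_diff[OF g g']
    by (simp add: has_fourier_transform_iff tendsto_const_iff)
  then have "AE \<xi> in lborel. ennreal ((norm (g \<xi> - g' \<xi>))\<^sup>2) = 0"
    by (subst nn_integral_0_iff_AE[symmetric]) auto
  then show ?thesis by eventually_elim simp
qed

lemma has_fourier_transform_fourier_integral:
  assumes "square_integrable f" and "square_integrable (fourier_integral f)"
    and supp: "\<And>x. B < \<bar>x\<bar> \<Longrightarrow> f x = 0"
  shows "has_fourier_transform f (fourier_integral f)"
proof -
  have "truncation R f = f" if "B \<le> R" for R
    using supp that by (force simp: truncation_def indicator_def abs_le_iff fun_eq_iff not_le[symmetric])
  then have "\<forall>\<^sub>F R in at_top. (\<integral>\<^sup>+ \<xi>. ennreal ((norm (fourier_integral f \<xi>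
      - fourier_integral (truncation R f) \<xi>))\<^sup>2) \<partial>lborel) = 0"
    by (intro eventually_mono[OF eventually_ge_at_top[of B]]) simp
  with assms show ?thesis
    by (auto simp: has_fourier_transform_iff intro: tendsto_eventually)
qed

section \<open>Sobolev norms\<close>

abbreviation sobolev_density :: "real \<Rightarrow> (real \<Rightarrow> 'a::real_normed_vector) \<Rightarrow> real \<Rightarrow> real" where
  "sobolev_density s g \<equiv> \<lambda>\<xi>. (1 + \<xi>\<^sup>2) powr s * (norm (g \<xi>))\<^sup>2"

lemma sobolev_norm_eq:
  assumes g: "has_fourier_transform f g"
  shows "sobolev_norm s f = sqrt (integral\<^sup>L lborel (sobolev_density s g))"
proof -
  have ft: "has_fourier_transform f (fourier_transform f)"
    unfolding fourier_transform_def using g by (rule someI[where P="has_fourier_transform f"])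
  note [measurable] = ft[THEN has_fourier_transform_measurable] g[THEN has_fourier_transform_measurable]
  have "AE \<xi> in lborel. fourier_transform f \<xi> = g \<xi>"
    by (rule has_fourier_transform_AE_unique[OF ft g])
  then show ?thesis
    unfolding sobolev_norm_def
    by (intro arg_cong[where f=sqrt] integral_cong_AE) (auto elim!: eventually_mono)
qed

lemma sobolev_density_mono:
  fixes w :: "real \<Rightarrow> real"
  assumes "\<And>\<xi>. norm (g \<xi>) \<le> w \<xi>"
  shows "sobolev_density s g \<xi> \<le> sobolev_density s w \<xi>"
  using assms by (auto intro!: mult_left_mono power_mono)

lemma integrable_sobolev_density_dominated:
  fixes w :: "real \<Rightarrow> real"
  assumes "has_fourier_transform f g" and "integrable lborel (sobolev_density s w)"
    and "\<And>\<xi>. norm (g \<xi>) \<le> w \<xi>"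
  shows "integrable lborel (sobolev_density s g)"
proof (rule Bochner_Integration.integrable_bound[OF assms(2)])
  note [measurable] = assms(1)[THEN has_fourier_transform_measurable]
  show "sobolev_density s g \<in> borel_measurable lborel" by measurable
qed (use sobolev_density_mono[of g, OF assms(3)] in simp)

lemma sobolev_spaceI_dominated:
  fixes w :: "real \<Rightarrow> real"
  assumes "has_fourier_transform f g" and "integrable lborel (sobolev_density s w)"
    and "\<And>\<xi>. norm (g \<xi>) \<le> w \<xi>"
  shows "f \<in> sobolev_space s"
  using assms integrable_sobolev_density_dominated[OF assms] by (auto simp: sobolev_space_def)

lemma sobolev_norm_tendsto_0_dominated:
  fixes f :: "'a::first_countable_topology \<Rightarrow> real \<Rightarrow> real" and w :: "real \<Rightarrow> real"
  assumes g: "\<And>\<tau>. \<tau> \<in> S - {a} \<Longrightarrow> has_fourier_transform (f \<tau>) (g \<tau>)"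
    and w: "integrable lborel (sobolev_density s w)"
    and dom: "\<And>\<tau> \<xi>. \<tau> \<in> S - {a} \<Longrightarrow> norm (g \<tau> \<xi>) \<le> w \<xi>"
    and lim: "AE \<xi> in lborel. ((\<lambda>\<tau>. g \<tau> \<xi>) \<longlongrightarrow> 0) (at a within S)"
  shows "((\<lambda>\<tau>. sobolev_norm s (f \<tau>)) \<longlongrightarrow> 0) (at a within S)"
  unfolding tendsto_at_iff_sequentially
proof (intro allI impI)
  fix X assume "\<forall>i. X i \<in> S - {a}" and X_lim: "X \<longlonglongrightarrow> a"
  then have X: "X n \<in> S - {a}" for n by blast
  note [measurable] = g[OF X, THEN has_fourier_transform_measurable]
  have "(\<lambda>n. integral\<^sup>L lborel (sobolev_density s (g (X n)))) \<longlonglongrightarrow> integral\<^sup>L lborel (\<lambda>_::real. 0::real)"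
  proof (rule integral_dominated_convergence)
    show "AE \<xi> in lborel. (\<lambda>n. sobolev_density s (g (X n)) \<xi>) \<longlonglongrightarrow> 0"
      using lim
    proof eventually_elim
      fix \<xi> assume "((\<lambda>\<tau>. g \<tau> \<xi>) \<longlongrightarrow> 0) (at a within S)"
      then have "(\<lambda>n. g (X n) \<xi>) \<longlonglongrightarrow> 0"
        using X X_lim by (simp add: tendsto_at_iff_sequentially o_def)
      then show "(\<lambda>n. sobolev_density s (g (X n)) \<xi>) \<longlonglongrightarrow> 0"
        by (auto intro!: tendsto_eq_intros)
    qed
    show "AE \<xi> in lborel. norm (sobolev_density s (g (X n)) \<xi>) \<le> sobolev_density s w \<xi>" for n
      using sobolev_density_mono[of "g (X n)", OF dom[OF X]] by simp
  qed (use w in auto)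
  then have "(\<lambda>n. sqrt (integral\<^sup>L lborel (sobolev_density s (g (X n))))) \<longlonglongrightarrow> sqrt 0"
    by (intro tendsto_real_sqrt) simp
  then show "((\<lambda>\<tau>. sobolev_norm s (f \<tau>)) \<circ> X) \<longlonglongrightarrow> 0"
    by (simp add: o_def sobolev_norm_eq[OF g[OF X]])
qed

lemma continuous_into_sobolev_dominated:
  fixes w :: "real \<Rightarrow> real"
  assumes g: "\<And>t. t \<in> I \<Longrightarrow> has_fourier_transform (u t) (g t)"
    and w: "integrable lborel (sobolev_density s w)"
    and dom: "\<And>t \<xi>. t \<in> I \<Longrightarrow> norm (g t \<xi>) \<le> w \<xi>"
    and cont: "AE \<xi> in lborel. continuous_on I (\<lambda>t. g t \<xi>)"
  shows "continuous_into_sobolev s I u"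
  unfolding continuous_into_sobolev_def
proof (intro conjI ballI)
  show "u t \<in> sobolev_space s" if "t \<in> I" for t
    using g[OF that] w dom[OF that] by (rule sobolev_spaceI_dominated)
  fix t assume t: "t \<in> I"
  show "((\<lambda>\<tau>. sobolev_norm s (\<lambda>x. u \<tau> x - u t x)) \<longlongrightarrow> 0) (at t within I)"
  proof (rule sobolev_norm_tendsto_0_dominated)
    show "has_fourier_transform (\<lambda>x. u \<tau> x - u t x) (\<lambda>\<xi>. g \<tau> \<xi> - g t \<xi>)" if "\<tau> \<in> I - {t}" for \<tau>
      using that t by (intro has_fourier_transform_diff g) auto
    show "integrable lborel (sobolev_density s (\<lambda>\<xi>. 2 * w \<xi>))"
      using integrable_mult_right[OF w, of 4] by (simp add: power_mult_distrib mult.left_commute)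
    show "norm (g \<tau> \<xi> - g t \<xi>) \<le> 2 * w \<xi>" if "\<tau> \<in> I - {t}" for \<tau> \<xi>
      using norm_triangle_ineq4[of "g \<tau> \<xi>" "g t \<xi>"] dom[of \<tau> \<xi>] dom[of t \<xi>] that t by auto
    show "AE \<xi> in lborel. ((\<lambda>\<tau>. g \<tau> \<xi> - g t \<xi>) \<longlongrightarrow> 0) (at t within I)"
      using cont by eventually_elim (use t in \<open>simp add: continuous_on_def LIM_zero\<close>)
  qed
qed

lemma integrable_one_plus_square_powr:
  fixes q :: real
  assumes q: "q < - 1 / 2"
  shows "integrable lborel (\<lambda>x. (1 + x\<^sup>2) powr q)"
proof -
  define f where "f x = (1 + x\<^sup>2) powr q" for x :: real
  have cont: "continuous_on S f" for S
    unfolding f_def by (intro continuous_intros) (simp add: add_nonneg_eq_0_iff)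
  then have [measurable]: "f \<in> borel_measurable borel" by (rule borel_measurable_continuous_onI)
  have "(\<lambda>x::real. x powr (2 * q)) absolutely_integrable_on {1..}"
    using has_integral_powr_to_inf[of "2 * q" 1] q
    by (intro nonnegative_absolutely_integrable_1) (auto simp: integrable_on_def)
  then have "set_integrable lborel {1..} (\<lambda>x::real. x powr (2 * q))"
    unfolding set_integrable_def by (subst (asm) integrable_completion) auto
  then have right: "set_integrable lborel {1..} f"
  proof (rule set_integrable_bound)
    show "AE x in lborel. x \<in> {1..} \<longrightarrow> norm (f x) \<le> norm (x powr (2 * q))"
    proof (intro AE_I2 impI)
      fix x :: real assume x: "x \<in> {1..}"
      have "(1 + x\<^sup>2) powr q \<le> (x\<^sup>2) powr q"
        using x q by (intro powr_mono2') auto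
      also have "\<dots> = x powr (2 * q)"
        using x powr_powr[of x 2 q] by simp
      finally show "norm (f x) \<le> norm (x powr (2 * q))" by (simp add: f_def)
    qed
  qed (simp add: set_borel_measurable_def)
  have middle: "set_integrable lborel {-1..1} f"
    unfolding set_integrable_def by (intro borel_integrable_compact cont) auto
  have left: "set_integrable lborel {..-1} f"
    using lborel_integrable_real_affine[OF right[unfolded set_integrable_def], of "-1" 0]
    by (simp add: set_integrable_def f_def indicator_def le_minus_iff)
  have "set_integrable lborel ({..-1} \<union> ({-1..1} \<union> {1..})) f"
    by (intro set_integrable_Un left middle right) auto
  also have "{..-1} \<union> ({-1..1} \<union> {1..}) = (UNIV :: real set)" by auto
  finally show ?thesis by (simp add: set_integrable_def f_def[abs_def])
qed

lemma integrable_sobolev_density_quadratic_decay: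
  assumes "s < 3 / 2"
  shows "integrable lborel (sobolev_density s (\<lambda>\<xi>. K / (1 + \<xi>\<^sup>2)))"
proof -
  have "sobolev_density s (\<lambda>\<xi>. K / (1 + \<xi>\<^sup>2)) \<xi> = K\<^sup>2 * (1 + \<xi>\<^sup>2) powr (s - 2)" for \<xi>
    using add_pos_nonneg[of 1 "\<xi>\<^sup>2"] by (simp add: powr_diff powr_numeral power_divide)
  then show ?thesis
    using integrable_one_plus_square_powr[of "s - 2"] assms by simp
qed

lemma square_integrable_quadratic_decay:
  fixes g :: "real \<Rightarrow> 'a::{banach, second_countable_topology}"
  assumes [measurable]: "g \<in> borel_measurable borel" and g: "\<And>\<xi>. norm (g \<xi>) \<le> K / (1 + \<xi>\<^sup>2)"
  shows "square_integrable g"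
proof -
  have "1 + \<xi>\<^sup>2 \<noteq> 0" for \<xi> :: real
    using add_pos_nonneg[of 1 "\<xi>\<^sup>2"] by simp
  then have "integrable lborel (\<lambda>\<xi>. (K / (1 + \<xi>\<^sup>2))\<^sup>2)"
    using integrable_sobolev_density_quadratic_decay[of 0 K] by (simp add: power_divide)
  then have "integrable lborel (\<lambda>\<xi>. (norm (g \<xi>))\<^sup>2)"
    by (rule Bochner_Integration.integrable_bound) (use g in \<open>simp_all add: power_mono\<close>)
  then show ?thesis by (simp add: square_integrable_def)
qed

section \<open>Tents\<close>

definition tent :: "real \<Rightarrow> real \<Rightarrow> real \<Rightarrow> real \<Rightarrow> real" where
  "tent b h p x = h * max 0 (min ((x + b) / (b + p)) ((b - x) / (b - p)))"

lemma continuous_on_tent [continuous_intros]: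
  "continuous_on S f \<Longrightarrow> continuous_on S (\<lambda>x. tent b h p (f x))"
  unfolding tent_def divide_inverse by (intro continuous_intros)

lemma tent_nonneg: "0 \<le> h \<Longrightarrow> 0 \<le> tent b h p x"
  by (simp add: tent_def)

lemma tent_outside:
  assumes "\<bar>p\<bar> < b" and "b < \<bar>x\<bar>"
  shows "tent b h p x = 0"
proof -
  have "(x + b) / (b + p) < 0 \<or> (b - x) / (b - p) < 0"
    using assms by (auto simp: divide_less_0_iff)
  then show ?thesis by (auto simp: tent_def)
qed

lemma tent_reflect: "tent b h (- p) (- x) = tent b h p x"
  by (simp add: tent_def min.commute add.commute)

lemma tent_on_left_flank:
  assumes p: "\<bar>p\<bar> < b" and y: "y \<in> {0..1}"
  shows "tent b h p (y * (b + p) - b) = h * y"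
proof -
  have "y * (2 * b) \<le> 1 * (2 * b)" using y p by (intro mult_right_mono) auto
  then have "y \<le> (b - (y * (b + p) - b)) / (b - p)"
    using p by (simp add: pos_le_divide_eq algebra_simps)
  moreover have "(y * (b + p) - b + b) / (b + p) = y" using p by simp
  ultimately show ?thesis using y by (simp only: tent_def) (simp add: min_absorb1)
qed

lemma tent_on_flank:
  assumes p: "\<bar>p\<bar> < b" and c: "c = -b \<or> c = b" and y: "y \<in> {0..1}"
  shows "tent b h p (c + y * (p - c)) = h * y"
  using c
proof
  assume "c = -b"
  then show ?thesis using tent_on_left_flank[OF p y, of h] by (simp add: add.commute)
next
  assume "c = b"
  then have "- (c + y * (p - c)) = y * (b + - p) - b" by (simp add: algebra_simps)
  then show ?thesis
    using tent_on_left_flank[of "- p" b y h] p y tent_reflect[of b h p "c + y * (p - c)"] by simp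
qed

lemma integral_lborel_split:
  fixes g :: "real \<Rightarrow> 'a::euclidean_space"
  assumes g: "continuous_on {a..c} g" and supp: "\<And>x. x \<notin> {a..c} \<Longrightarrow> g x = 0" and p: "p \<in> {a..c}"
  shows "integral\<^sup>L lborel g = integral {a..p} g + integral {p..c} g"
proof -
  have "integral\<^sup>L lborel g = (LBINT x:{a..c}. g x)"
    unfolding set_lebesgue_integral_def using supp
    by (intro Bochner_Integration.integral_cong) (auto simp: indicator_def)
  also have "\<dots> = integral {a..c} g"
    by (intro set_borel_integral_eq_integral(2) borel_integrable_atLeastAtMost' g)
  also have "\<dots> = integral {a..p} g + integral {p..c} g"
    using p by (intro Henstock_Kurzweil_Integration.integral_combine[symmetric]
        integrable_continuous_interval g) auto
  finally show ?thesis .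
qed

lemma integral_closed_segment_param:
  fixes g :: "real \<Rightarrow> 'a::euclidean_space"
  assumes "continuous_on (closed_segment c p) g"
  shows "(p - c) *\<^sub>R integral {0..1} (\<lambda>y. g (c + y * (p - c))) = integral {c..p} g - integral {p..c} g"
proof -
  have "((\<lambda>y. (p - c) *\<^sub>R g (c + y * (p - c))) has_integral
      (integral {c + 0 * (p - c)..c + 1 * (p - c)} g - integral {c + 1 * (p - c)..c + 0 * (p - c)} g)) {0..1}"
  proof (rule has_integral_substitution_general[OF finite.emptyI])
    have "closed_segment c p = {min c p..max c p}"
      by (auto simp: closed_segment_eq_real_ivl)
    moreover have "(\<lambda>y. c + y * (p - c)) ` {0..1} = closed_segment c p"
      by (simp add: closed_segment_image_interval algebra_simps image_def scaleR_conv_of_real)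
    ultimately show "(\<lambda>y. c + y * (p - c)) ` {0..1} \<subseteq> {min c p..max c p}"
      "continuous_on {min c p..max c p} g"
      using assms by simp_all
  qed (auto intro!: continuous_intros derivative_eq_intros)
  from integral_unique[OF this] show ?thesis by simp
qed

text \<open>
  The side of the tent from \<open>(c, 0)\<close> to the peak \<open>(p, h)\<close> is parametrised by the fraction \<open>y\<close> of the
  height, so that it is traversed backwards when \<open>c = b\<close>.
\<close>

definition flank_integral :: "(real \<Rightarrow> real \<Rightarrow> 'a::euclidean_space) \<Rightarrow> real \<Rightarrow> real \<Rightarrow> real \<Rightarrow> 'a" where
  "flank_integral G h c p = (p - c) *\<^sub>R integral {0..1} (\<lambda>y. G (c + y * (p - c)) (h * y))"

lemma integral_tent:
  assumes p: "\<bar>p\<bar> < b" and cont: "continuous_on UNIV (\<lambda>x. G x (tent b h p x))"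
    and zero: "\<And>x. G x 0 = 0"
  shows "(LBINT x. G x (tent b h p x)) = flank_integral G h (-b) p - flank_integral G h b p"
proof -
  define g where "g = (\<lambda>x. G x (tent b h p x))"
  have g: "continuous_on S g" for S
    unfolding g_def using cont by (rule continuous_on_subset) simp
  have flank: "flank_integral G h c p = integral {c..p} g - integral {p..c} g" if "c = -b \<or> c = b" for c
  proof -
    have "flank_integral G h c p = (p - c) *\<^sub>R integral {0..1} (\<lambda>y. g (c + y * (p - c)))"
      unfolding flank_integral_def g_def
      by (intro arg_cong[where f="scaleR _"] integral_cong) (simp add: tent_on_flank[OF p that])
    then show ?thesis by (simp add: integral_closed_segment_param[OF g])
  qed
  have "integral\<^sup>L lborel g = integral {-b..p} g + integral {p..b} g"
    using p by (intro integral_lborel_split g) (auto simp: g_def zero tent_outside)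
  also have "\<dots> = flank_integral G h (-b) p - flank_integral G h b p"
    using p by (simp add: flank)
  finally show ?thesis by (simp add: g_def)
qed

lemma integral_tent_eq_area:
  assumes "\<bar>p\<bar> < b"
  shows "(LBINT x. tent b h p x) = b * h"
proof -
  have flank: "flank_integral (\<lambda>x v. v) h c p = (p - c) * h / 2" for c
    by (simp add: flank_integral_def)
  have "(LBINT x. tent b h p x) = flank_integral (\<lambda>x v. v) h (-b) p - flank_integral (\<lambda>x v. v) h b p"
    by (intro integral_tent assms continuous_intros) simp
  also have "\<dots> = b * h" by (simp add: flank field_simps)
  finally show ?thesis .
qed

lemma has_integral_times_cis:
  fixes a k :: real
  assumes "k \<noteq> 0"
  shows "((\<lambda>y. of_real y * cis (- (a + y * k))) has_integral
    (cis (- (a + k)) * (\<i> / of_real k) + (cis (- (a + k)) - cis (- a)) / (of_real k)\<^sup>2)) {0..1}"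
proof -
  define F where "F y = cis (- (a + y * k)) * (\<i> * of_real y / of_real k + 1 / (of_real k)\<^sup>2)" for y
  have "((\<lambda>y. of_real y * cis (- (a + y * k))) has_integral (F 1 - F 0)) {0..1}"
  proof (rule fundamental_theorem_of_calculus)
    fix y :: real
    show "(F has_vector_derivative of_real y * cis (- (a + y * k))) (at y within {0..1})"
      unfolding F_def has_vector_derivative_def using assms
      by (auto intro!: derivative_eq_intros simp: fun_eq_iff scaleR_conv_of_real field_simps power2_eq_square)
  qed simp
  also have "F 1 - F 0 = cis (- (a + k)) * (\<i> / of_real k) + (cis (- (a + k)) - cis (- a)) / (of_real k)\<^sup>2"
    by (simp add: F_def distrib_left diff_divide_distrib)
  finally show ?thesis .
qed

lemma flank_integral_cis:
  assumes "\<xi> \<noteq> 0" and "p \<noteq> c"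
  shows "flank_integral (\<lambda>x v. cis (- (x * \<xi>)) * complex_of_real v) h c p
    = \<i> * of_real (h / \<xi>) * cis (- (p * \<xi>))
      + of_real (h / (p - c)) * (cis (- (p * \<xi>)) - cis (- (c * \<xi>))) / (of_real \<xi>)\<^sup>2"
proof -
  define w where "w = p - c"
  have "w \<noteq> 0" using assms by (simp add: w_def)
  then have k: "w * \<xi> \<noteq> 0" using assms by simp
  have "p = c + w" by (simp add: w_def)
  then have end_phase: "c * \<xi> + w * \<xi> = p * \<xi>" by (simp add: distrib_right)
  have "flank_integral (\<lambda>x v. cis (- (x * \<xi>)) * complex_of_real v) h c p
      = of_real (w * h) * integral {0..1} (\<lambda>y. of_real y * cis (- (c * \<xi> + y * (w * \<xi>))))"
    unfolding flank_integral_def w_def[symmetric]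
    by (simp add: scaleR_conv_of_real distrib_right mult.assoc mult.left_commute flip: integral_mult_right)
       (simp add: mult_ac)
  also have "\<dots> = of_real (w * h) * (cis (- (p * \<xi>)) * (\<i> / of_real (w * \<xi>))
      + (cis (- (p * \<xi>)) - cis (- (c * \<xi>))) / (of_real (w * \<xi>))\<^sup>2)"
    unfolding integral_unique[OF has_integral_times_cis[OF k]] end_phase ..
  also have "\<dots> = \<i> * of_real (h / \<xi>) * cis (- (p * \<xi>))
      + of_real (h / w) * (cis (- (p * \<xi>)) - cis (- (c * \<xi>))) / (of_real \<xi>)\<^sup>2"
    using assms(1) \<open>w \<noteq> 0\<close> by (simp add: field_simps power2_eq_square)
  finally show ?thesis by (simp only: w_def)
qed

lemma fourier_integral_tent:
  assumes p: "\<bar>p\<bar> < b" and \<xi>: "\<xi> \<noteq> 0"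
  shows "fourier_integral (tent b h p) \<xi> =
    (of_real (h / (b + p)) * (cis (- (p * \<xi>)) - cis (b * \<xi>))
      + of_real (h / (b - p)) * (cis (- (p * \<xi>)) - cis (- (b * \<xi>)))) / (of_real \<xi>)\<^sup>2"
proof -
  have "h / (p - b) = - (h / (b - p))" using minus_divide_right[of h "b - p"] by simp
  moreover have "fourier_integral (tent b h p) \<xi>
      = flank_integral (\<lambda>x v. cis (- (x * \<xi>)) * complex_of_real v) h (-b) p
        - flank_integral (\<lambda>x v. cis (- (x * \<xi>)) * complex_of_real v) h b p"
    unfolding fourier_integral_def by (intro integral_tent p continuous_intros) simp
  ultimately show ?thesis
    using p by (simp add: flank_integral_cis[OF \<xi>] add.commute[of p] add_divide_distrib)
qed

lemma norm_cis_diff_le: "norm (cis x - cis y) \<le> 2"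
  using norm_triangle_ineq4[of "cis x" "cis y"] by simp

lemma norm_fourier_integral_tent_le_area:
  assumes "\<bar>p\<bar> < b" and "0 \<le> h"
  shows "norm (fourier_integral (tent b h p) \<xi>) \<le> b * h"
  using norm_fourier_integral_le[of "tent b h p" \<xi>] assms
  by (simp add: tent_nonneg integral_tent_eq_area)

lemma norm_fourier_integral_tent_decay:
  assumes p: "\<bar>p\<bar> \<le> q" and q: "q < b" and h: "0 \<le> h"
  shows "norm (fourier_integral (tent b h p) \<xi>) \<le> (b * h + 4 * h / (b - q)) / (1 + \<xi>\<^sup>2)"
proof -
  have pb: "\<bar>p\<bar> < b" using p q by simp
  have high: "norm (fourier_integral (tent b h p) \<xi>) * \<xi>\<^sup>2 \<le> 4 * h / (b - q)"
  proof (cases "\<xi> = 0")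
    case False
    have flank: "norm (of_real (h / d) * (cis x - cis y)) \<le> 2 * h / (b - q)" if "b - q \<le> d" for d x y
    proof -
      have "0 \<le> d" "h / d \<le> h / (b - q)" "0 \<le> h / d"
        using that q h by (auto intro!: divide_left_mono mult_pos_pos)
      then show ?thesis
        using mult_mono[of "h / d" "h / (b - q)" "norm (cis x - cis y)" 2] norm_cis_diff_le[of x y]
        by (simp add: norm_mult norm_divide abs_of_nonneg[OF h] abs_of_nonneg[OF \<open>0 \<le> d\<close>] mult.commute)
    qed
    have "norm (of_real (h / (b + p)) * (cis (- (p * \<xi>)) - cis (b * \<xi>))
        + of_real (h / (b - p)) * (cis (- (p * \<xi>)) - cis (- (b * \<xi>)))) \<le> 2 * h / (b - q) + 2 * h / (b - q)"
      using p by (intro norm_triangle_mono flank) auto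
    then show ?thesis
      using False by (simp add: fourier_integral_tent[OF pb] norm_divide norm_power del: of_real_divide)
  qed (use q h in auto)
  with norm_fourier_integral_tent_le_area[OF pb h, of \<xi>]
  have "norm (fourier_integral (tent b h p) \<xi>) * (1 + \<xi>\<^sup>2) \<le> b * h + 4 * h / (b - q)"
    by (simp add: ring_distribs add_mono)
  then show ?thesis
    using add_pos_nonneg[of 1 "\<xi>\<^sup>2"] by (simp add: pos_le_divide_eq)
qed

lemma has_fourier_transform_tent:
  assumes p: "\<bar>p\<bar> < b" and h: "0 \<le> h"
  shows "has_fourier_transform (tent b h p) (fourier_integral (tent b h p))"
proof (rule has_fourier_transform_fourier_integral)
  have cont: "continuous_on UNIV (tent b h p)"
    using continuous_on_tent[OF continuous_on_id] by simp
  show "square_integrable (tent b h p)"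
    using cont tent_outside[OF p] by (rule square_integrable_compact_support)
  show "square_integrable (fourier_integral (tent b h p))"
    using norm_fourier_integral_tent_decay[OF order.refl p h]
    by (intro square_integrable_quadratic_decay borel_measurable_fourier_integral
        borel_measurable_continuous_onI[OF cont])
qed (rule tent_outside[OF p])

lemma continuous_into_sobolev_tent:
  assumes s: "s < 3 / 2" and h: "0 \<le> h" and q: "q < b"
    and p: "continuous_on I p" "\<And>t. t \<in> I \<Longrightarrow> \<bar>p t\<bar> \<le> q"
  shows "continuous_into_sobolev s I (\<lambda>t. tent b h (p t))"
proof (rule continuous_into_sobolev_dominated)
  have pb: "\<bar>p t\<bar> < b" if "t \<in> I" for t using p(2)[OF that] q by simp
  show "has_fourier_transform (tent b h (p t)) (fourier_integral (tent b h (p t)))" if "t \<in> I" for t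
    by (rule has_fourier_transform_tent[OF pb[OF that] h])
  show "integrable lborel (sobolev_density s (\<lambda>\<xi>. (b * h + 4 * h / (b - q)) / (1 + \<xi>\<^sup>2)))"
    by (rule integrable_sobolev_density_quadratic_decay[OF s])
  show "norm (fourier_integral (tent b h (p t)) \<xi>) \<le> (b * h + 4 * h / (b - q)) / (1 + \<xi>\<^sup>2)"
    if "t \<in> I" for t \<xi>
    by (rule norm_fourier_integral_tent_decay[OF p(2)[OF that] q h])
  show "AE \<xi> in lborel. continuous_on I (\<lambda>t. fourier_integral (tent b h (p t)) \<xi>)"
    using AE_lborel_singleton[of 0]
  proof eventually_elim
    fix \<xi> :: real assume "\<xi> \<noteq> 0"
    have "continuous_on I (\<lambda>t. (of_real (h / (b + p t)) * (cis (- (p t * \<xi>)) - cis (b * \<xi>))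
        + of_real (h / (b - p t)) * (cis (- (p t * \<xi>)) - cis (- (b * \<xi>)))) / (of_real \<xi>)\<^sup>2)"
      using \<open>\<xi> \<noteq> 0\<close> by (intro continuous_intros p(1)) (auto dest: pb)
    then show "continuous_on I (\<lambda>t. fourier_integral (tent b h (p t)) \<xi>)"
      by (rule continuous_on_eq) (simp add: fourier_integral_tent[OF pb \<open>\<xi> \<noteq> 0\<close>])
  qed
qed

lemma sobolev_norm_narrow_tent_tendsto_0:
  assumes s: "s < 3 / 2" and m: "0 \<le> m"
  shows "((\<lambda>b. sobolev_norm s (tent b (m * b) 0)) \<longlongrightarrow> 0) (at_right 0)"
proof -
  have "((\<lambda>b. sobolev_norm s (tent b (m * b) 0)) \<longlongrightarrow> 0) (at 0 within {0..1})"
  proof (rule sobolev_norm_tendsto_0_dominated)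
    fix b \<xi> :: real assume b: "b \<in> {0..1} - {0}"
    show "has_fourier_transform (tent b (m * b) 0) (fourier_integral (tent b (m * b) 0))"
      using b m by (intro has_fourier_transform_tent) auto
    have "b * b \<le> 1" using b by (auto intro: mult_le_one)
    then have "b * (m * b) + 4 * (m * b) / (b - 0) \<le> 5 * m"
      using b m mult_left_le[of "b * b" m] by (simp add: ac_simps)
    then show "norm (fourier_integral (tent b (m * b) 0) \<xi>) \<le> 5 * m / (1 + \<xi>\<^sup>2)"
      using b m by (intro order.trans[OF norm_fourier_integral_tent_decay[where q=0]] divide_right_mono) auto
  next
    show "integrable lborel (sobolev_density s (\<lambda>\<xi>. 5 * m / (1 + \<xi>\<^sup>2)))"
      by (rule integrable_sobolev_density_quadratic_decay[OF s])
    show "AE \<xi> in lborel. ((\<lambda>b. fourier_integral (tent b (m * b) 0) \<xi>) \<longlongrightarrow> 0) (at 0 within {0..1})"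
    proof (rule AE_I2, rule Lim_null_comparison)
      fix \<xi>
      show "\<forall>\<^sub>F b in at 0 within {0..1}.
          norm (fourier_integral (tent b (m * b) 0) \<xi>) \<le> b * (m * b)"
        using m unfolding eventually_at_filter
        by (intro always_eventually allI impI norm_fourier_integral_tent_le_area) auto
      show "((\<lambda>b. b * (m * b)) \<longlongrightarrow> 0) (at 0 within {0..1})"
        by (auto intro!: tendsto_eq_intros)
    qed
  qed
  then show ?thesis by (simp add: at_within_Icc_at_right)
qed

lemma one_le_norm_cis_diff:
  assumes "cos (x - y) \<le> 0"
  shows "1 \<le> norm (cis x - cis y)"
proof -
  have "1 \<le> Re (1 - cis (x - y))" using assms by simp
  also have "\<dots> \<le> norm (1 - cis (x - y))" by (rule complex_Re_le_cmod)
  also have "\<dots> = norm (cis y * (1 - cis (x - y)))" by (simp add: norm_mult)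
  also have "\<dots> = norm (cis x - cis y)"
    by (simp add: right_diff_distrib cis_mult norm_minus_commute)
  finally show ?thesis .
qed

text \<open>
  For \<open>2 \<le> (b - p) \<xi> \<le> 3\<close> the two points bounding the steep side are out of phase, so their
  contribution to the Fourier integral dominates.
\<close>

lemma norm_fourier_integral_steep_tent_ge:
  assumes p: "0 \<le> p" "p < b" and gap: "b - p \<le> b / 4" and h: "0 \<le> h"
    and \<xi>: "2 / (b - p) \<le> \<xi>" "\<xi> \<le> 3 / (b - p)"
  shows "h / (2 * (b - p)) / \<xi>\<^sup>2 \<le> norm (fourier_integral (tent b h p) \<xi>)"
proof -
  define \<alpha> \<beta> where "\<alpha> = h / (b + p)" and "\<beta> = h / (b - p)"
  define wide where "wide = cis (- (p * \<xi>)) - cis (b * \<xi>)"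
  define steep where "steep = cis (- (p * \<xi>)) - cis (- (b * \<xi>))"
  have bp: "0 < b - p" using p by simp
  then have "0 < 2 / (b - p)" by simp
  with \<xi> have "0 < \<xi>" by linarith
  have nonneg: "0 \<le> \<alpha>" "0 \<le> \<beta>" using p h by (auto simp: \<alpha>_def \<beta>_def)
  have "\<alpha> \<le> h / (4 * (b - p))"
    unfolding \<alpha>_def using p gap h by (intro divide_left_mono) auto
  also have "\<dots> = \<beta> / 4" by (simp only: \<beta>_def divide_divide_eq_left mult.commute)
  finally have "4 * \<alpha> \<le> \<beta>" by simp
  have "1 \<le> norm steep"
  proof -
    have "2 \<le> (b - p) * \<xi>" "(b - p) * \<xi> \<le> 3" using \<xi> bp by (simp_all add: divide_simps mult.commute)
    then have "cos ((b - p) * \<xi>) \<le> 0"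
      using pi_gt3 pi_less_4 cos_monotone_0_pi_le[of "pi / 2" "(b - p) * \<xi>"] by simp
    then show ?thesis
      unfolding steep_def by (intro one_le_norm_cis_diff) (simp add: left_diff_distrib)
  qed
  then have "\<beta> \<le> norm (of_real \<beta> * steep)"
    using nonneg by (simp add: norm_mult mult_le_cancel_left1)
  moreover have "norm (of_real \<alpha> * wide) \<le> 2 * \<alpha>"
    using nonneg norm_cis_diff_le by (simp add: norm_mult wide_def mult_left_mono mult.commute[of 2])
  ultimately have "\<beta> / 2 \<le> norm (of_real \<alpha> * wide + of_real \<beta> * steep)"
    using \<open>4 * \<alpha> \<le> \<beta>\<close> norm_diff_ineq[of "of_real \<beta> * steep" "of_real \<alpha> * wide"] by (simp add: add.commute)
  then have "\<beta> / 2 / \<xi>\<^sup>2 \<le> norm (of_real \<alpha> * wide + of_real \<beta> * steep) / \<xi>\<^sup>2"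
    by (rule divide_right_mono) simp
  also have "\<dots> = norm (fourier_integral (tent b h p) \<xi>)"
    using p \<open>0 < \<xi>\<close> by (simp add: fourier_integral_tent norm_divide norm_power \<alpha>_def \<beta>_def wide_def steep_def)
  finally show ?thesis by (simp add: \<beta>_def mult.commute)
qed

lemma sobolev_density_steep_tent_ge:
  assumes s: "1 \<le> s" and p: "0 \<le> p" "p < b" and steep: "b - p \<le> b / 4" and h: "0 \<le> h"
    and \<xi>: "2 / (b - p) \<le> \<xi>" "\<xi> \<le> 3 / (b - p)"
  shows "h\<^sup>2 / 36 \<le> sobolev_density s (fourier_integral (tent b h p)) \<xi>"
proof -
  define \<epsilon> where "\<epsilon> = b - p"
  have \<epsilon>: "0 < \<epsilon>" using p by (simp add: \<epsilon>_def)
  then have "0 < 2 / \<epsilon>" by simp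
  with \<xi> have "0 < \<xi>" unfolding \<epsilon>_def by linarith
  have "\<epsilon> * \<xi> \<le> 3" using \<xi>(2) \<epsilon> unfolding \<epsilon>_def[symmetric] by (simp add: divide_simps mult.commute)
  then have "(\<epsilon> * \<xi>)\<^sup>2 \<le> 3\<^sup>2" using \<epsilon> \<open>0 < \<xi>\<close> by (intro power_mono) auto
  then have "h\<^sup>2 / 36 \<le> h\<^sup>2 / (4 * (\<epsilon> * \<xi>)\<^sup>2)"
    using \<epsilon> \<open>0 < \<xi>\<close> by (intro divide_left_mono) auto
  also have "\<dots> = \<xi>\<^sup>2 * (h / (2 * \<epsilon>) / \<xi>\<^sup>2)\<^sup>2"
    using \<epsilon> \<open>0 < \<xi>\<close> by (simp add: field_simps power2_eq_square)
  also have "\<dots> \<le> sobolev_density s (fourier_integral (tent b h p)) \<xi>"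
  proof (intro mult_mono power_mono)
    have "\<xi>\<^sup>2 \<le> (1 + \<xi>\<^sup>2) powr 1" by simp
    also have "\<dots> \<le> (1 + \<xi>\<^sup>2) powr s" using s by (intro powr_mono) auto
    finally show "\<xi>\<^sup>2 \<le> (1 + \<xi>\<^sup>2) powr s" .
    show "h / (2 * \<epsilon>) / \<xi>\<^sup>2 \<le> norm (fourier_integral (tent b h p) \<xi>)"
      unfolding \<epsilon>_def using assms by (intro norm_fourier_integral_steep_tent_ge)
  qed (use \<epsilon> h in auto)
  finally show ?thesis .
qed

lemma sobolev_norm_steep_tent_ge:
  assumes s: "1 \<le> s" "s < 3 / 2" and p: "0 \<le> p" "p < b" and steep: "b - p \<le> b / 4" and h: "0 \<le> h"
  shows "sqrt (h\<^sup>2 / 36 / (b - p)) \<le> sobolev_norm s (tent b h p)"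
proof -
  define I where "I = {2 / (b - p)..3 / (b - p)}"
  have pb: "\<bar>p\<bar> < b" using p by simp
  note ft = has_fourier_transform_tent[OF pb h]
  have "h\<^sup>2 / 36 / (b - p) = (LBINT \<xi>. indicator I \<xi> *\<^sub>R (h\<^sup>2 / 36))"
    using p by (simp add: I_def divide_right_mono field_simps)
  also have "\<dots> \<le> integral\<^sup>L lborel (sobolev_density s (fourier_integral (tent b h p)))"
  proof (rule integral_mono)
    show "integrable lborel (\<lambda>\<xi>. indicator I \<xi> *\<^sub>R (h\<^sup>2 / 36))"
      unfolding I_def by (intro borel_integrable_compact) auto
    show "integrable lborel (sobolev_density s (fourier_integral (tent b h p)))"
      using ft integrable_sobolev_density_quadratic_decay[OF s(2)]
        norm_fourier_integral_tent_decay[OF order.refl pb h] by (rule integrable_sobolev_density_dominated)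
    show "indicator I \<xi> *\<^sub>R (h\<^sup>2 / 36) \<le> sobolev_density s (fourier_integral (tent b h p)) \<xi>" for \<xi>
      using sobolev_density_steep_tent_ge[OF s(1) p steep h, of \<xi>] by (auto simp: I_def indicator_def)
  qed
  finally show ?thesis by (simp add: sobolev_norm_eq[OF ft])
qed

lemma sobolev_norm_tent_at_top:
  assumes s: "1 \<le> s" "s < 3 / 2" and b: "0 < b" and h: "0 < h"
  shows "filterlim (\<lambda>p. sobolev_norm s (tent b h p)) at_top (at_left b)"
proof (rule filterlim_at_top_mono)
  have "filterlim (\<lambda>p. inverse (b - p)) at_top (at_left b)"
    by (intro filterlim_inverse_at_top) (auto intro!: tendsto_eq_intros simp: eventually_at_filter)
  then have "filterlim (\<lambda>p. h\<^sup>2 / 36 * inverse (b - p)) at_top (at_left b)"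
    using h by (intro filterlim_tendsto_pos_mult_at_top[OF tendsto_const]) auto
  then show "filterlim (\<lambda>p. sqrt (h\<^sup>2 / 36 / (b - p))) at_top (at_left b)"
    unfolding divide_inverse[of _ "b - _"] by (rule filterlim_compose[OF sqrt_at_top])
  have "\<forall>\<^sub>F p in at_left b. p \<in> {3 / 4 * b<..<b}"
    using b by (intro eventually_at_left_real) simp
  then show "\<forall>\<^sub>F p in at_left b. sqrt (h\<^sup>2 / 36 / (b - p)) \<le> sobolev_norm s (tent b h p)"
    by eventually_elim (use b h in \<open>intro sobolev_norm_steep_tent_ge[OF s]; simp\<close>)
qed

section \<open>The Burgers flow of a tent\<close>

lemma k_times_cont_diff_has_derivative:
  assumes "k_times_cont_diff (Suc k) \<phi>"
  shows "(\<phi> has_derivative (\<lambda>(dt, dx). dt * partial_t \<phi> (t, x) + dx * partial_x \<phi> (t, x))) (at (t, x))"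
proof -
  have cont: "continuous_on UNIV (partial_x \<phi>)"
    using assms by (cases k) auto
  have dt: "((\<lambda>\<tau>. \<phi> (\<tau>, x)) has_real_derivative partial_t \<phi> (t, x)) (at t)" for t x
    using assms by (auto simp: partial_t_def DERIV_deriv_iff_real_differentiable)
  have dx: "((\<lambda>y. \<phi> (t, y)) has_real_derivative partial_x \<phi> (t, x)) (at x)" for t x
    using assms by (auto simp: partial_x_def DERIV_deriv_iff_real_differentiable)
  have "((\<lambda>(t, x). \<phi> (t, x)) has_derivative
      (\<lambda>(dt, dx). partial_t \<phi> (t, x) * dt + blinfun_mult_right (partial_x \<phi> (t, x)) dx))
      (at (t, x) within UNIV \<times> UNIV)"
  proof (rule has_derivative_partialsI)
    show "((\<lambda>t. \<phi> (t, x)) has_derivative (*) (partial_t \<phi> (t, x))) (at t within UNIV)"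
      using dt by (simp add: has_field_derivative_def)
    show "((\<lambda>x. \<phi> (t, x)) has_derivative blinfun_apply (blinfun_mult_right (partial_x \<phi> (t, x))))
        (at x within UNIV)" for t x
      using dx by (simp add: has_field_derivative_def)
    have "continuous_on UNIV (\<lambda>p. blinfun_mult_right (partial_x \<phi> p))"
      by (intro continuous_intros cont)
    then show "continuous (at (t, x) within UNIV \<times> UNIV) (\<lambda>(t, x). blinfun_mult_right (partial_x \<phi> (t, x)))"
      by (simp add: continuous_on_eq_continuous_at case_prod_unfold del: split_paired_All)
  qed auto
  then show ?thesis by (simp add: mult.commute split_beta)
qed

lemma k_times_cont_diff_chain_rule:
  assumes "k_times_cont_diff (Suc k) \<phi>"
    and "(a has_real_derivative a') (at r)" and "(b has_real_derivative b') (at r)"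
  shows "((\<lambda>r. \<phi> (a r, b r)) has_real_derivative
    a' * partial_t \<phi> (a r, b r) + b' * partial_x \<phi> (a r, b r)) (at r)"
proof -
  have "((\<lambda>r. (a r, b r)) has_derivative (\<lambda>d. (a' * d, b' * d))) (at r)"
    using assms(2,3) by (intro has_derivative_Pair) (simp_all add: has_field_derivative_def)
  from has_derivative_compose[OF this k_times_cont_diff_has_derivative[OF assms(1)]]
  show ?thesis
    unfolding has_field_derivative_def by (rule has_derivative_eq_rhs) (simp add: fun_eq_iff algebra_simps)
qed

definition burgers_pairing :: "(real \<times> real \<Rightarrow> real) \<Rightarrow> real \<Rightarrow> real \<Rightarrow> real \<Rightarrow> real" where
  "burgers_pairing \<phi> t x v = v * partial_t \<phi> (t, x) + v\<^sup>2 / 2 * partial_x \<phi> (t, x)"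

context
  fixes \<phi> :: "real \<times> real \<Rightarrow> real"
  assumes \<phi>: "k_times_cont_diff (Suc 0) \<phi>"
begin

lemma continuous_on_cont_diff:
  assumes "continuous_on S a" and "continuous_on S b"
  shows "continuous_on S (\<lambda>x. \<phi> (a x, b x))"
    and "continuous_on S (\<lambda>x. partial_t \<phi> (a x, b x))"
    and "continuous_on S (\<lambda>x. partial_x \<phi> (a x, b x))"
proof -
  have "continuous_on UNIV \<phi>" "continuous_on UNIV (partial_t \<phi>)" "continuous_on UNIV (partial_x \<phi>)"
    using \<phi> by auto
  from this[THEN continuous_on_compose2, OF continuous_on_Pair[OF assms]]
  show "continuous_on S (\<lambda>x. \<phi> (a x, b x))"
    "continuous_on S (\<lambda>x. partial_t \<phi> (a x, b x))" "continuous_on S (\<lambda>x. partial_x \<phi> (a x, b x))"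
    by simp_all
qed

lemma integral_by_parts_cont_diff:
  "integral {0..1} (\<lambda>y. y * \<phi> (t, c + y * w) + y\<^sup>2 / 2 * (w * partial_x \<phi> (t, c + y * w))) = \<phi> (t, c + w) / 2"
proof -
  have "((\<lambda>y. y\<^sup>2 / 2 * \<phi> (t, c + y * w)) has_real_derivative
      y * \<phi> (t, c + y * w) + y\<^sup>2 / 2 * (w * partial_x \<phi> (t, c + y * w))) (at y)" for y
  proof -
    have "((\<lambda>y. \<phi> (t, c + y * w)) has_real_derivative
        0 * partial_t \<phi> (t, c + y * w) + w * partial_x \<phi> (t, c + y * w)) (at y)"
      by (rule k_times_cont_diff_chain_rule[OF \<phi>]) (auto intro!: derivative_eq_intros)
    then show ?thesis by (auto intro!: derivative_eq_intros)
  qed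
  then have "((\<lambda>y. y * \<phi> (t, c + y * w) + y\<^sup>2 / 2 * (w * partial_x \<phi> (t, c + y * w))) has_integral
      1\<^sup>2 / 2 * \<phi> (t, c + 1 * w) - 0\<^sup>2 / 2 * \<phi> (t, c + 0 * w)) {0..1}"
    by (intro fundamental_theorem_of_calculus)
      (auto simp flip: has_real_derivative_iff_has_vector_derivative intro: has_field_derivative_at_within)
  from integral_unique[OF this] show ?thesis by simp
qed

text \<open>
  \<open>c + y (h t - c)\<close> is the characteristic carrying the value \<open>h y\<close>. In the coordinates \<open>(t, y)\<close> the weak
  form on one side of the peak is a divergence, and the two sides leave the same boundary term at
  the peak.
\<close>

lemma has_real_derivative_along_characteristic:
  "((\<lambda>t. (h * t - c) * (h * y * \<phi> (t, c + y * (h * t - c)))) has_real_derivative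
    (h * t - c) * burgers_pairing \<phi> t (c + y * (h * t - c)) (h * y)
      + h\<^sup>2 * (y * \<phi> (t, c + y * (h * t - c))
          + y\<^sup>2 / 2 * ((h * t - c) * partial_x \<phi> (t, c + y * (h * t - c))))) (at t)"
proof -
  have "((\<lambda>t. \<phi> (t, c + y * (h * t - c))) has_real_derivative
      1 * partial_t \<phi> (t, c + y * (h * t - c)) + h * y * partial_x \<phi> (t, c + y * (h * t - c))) (at t)"
    by (rule k_times_cont_diff_chain_rule[OF \<phi>]) (auto intro!: derivative_eq_intros)
  then show ?thesis
    unfolding burgers_pairing_def
    by (auto intro!: derivative_eq_intros simp: field_simps power2_eq_square)
qed

lemma flank_integral_conservation_law:
  "((\<lambda>t. flank_integral (\<lambda>x v. v * \<phi> (t, x)) h c (h * t)) has_real_derivative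
    flank_integral (burgers_pairing \<phi> t) h c (h * t) + h\<^sup>2 / 2 * \<phi> (t, h * t)) (at t)"
proof -
  note [continuous_intros] = continuous_on_cont_diff
  define X where "X = (\<lambda>t y. c + y * (h * t - c))"
  define bulk where "bulk = (\<lambda>t y. (h * t - c) * burgers_pairing \<phi> t (X t y) (h * y))"
  define flux where "flux = (\<lambda>t y. h\<^sup>2 * (y * \<phi> (t, X t y) + y\<^sup>2 / 2 * ((h * t - c) * partial_x \<phi> (t, X t y))))"
  have cont: "continuous_on S (\<lambda>p. bulk (fst p) (snd p))" "continuous_on S (\<lambda>p. flux (fst p) (snd p))" for S
    unfolding bulk_def flux_def X_def burgers_pairing_def by (intro continuous_intros; simp)+
  have cont_y: "continuous_on {0..1} (bulk t)" "continuous_on {0..1} (flux t)" for t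
    unfolding bulk_def flux_def X_def burgers_pairing_def by (intro continuous_intros; simp)+
  have "((\<lambda>t. integral (cbox 0 1) (\<lambda>y. (h * t - c) * (h * y * \<phi> (t, X t y)))) has_real_derivative
      integral (cbox 0 1) (\<lambda>y. bulk t y + flux t y)) (at t within UNIV)"
  proof (rule leibniz_rule_field_derivative)
    show "((\<lambda>t. (h * t - c) * (h * y * \<phi> (t, X t y))) has_real_derivative bulk t y + flux t y) (at t within UNIV)"
      for t y
      unfolding bulk_def flux_def X_def by (rule has_real_derivative_along_characteristic)
    show "(\<lambda>y. (h * t - c) * (h * y * \<phi> (t, X t y))) integrable_on cbox 0 1" for t
      unfolding X_def by (intro integrable_continuous continuous_intros)
    show "continuous_on (UNIV \<times> cbox 0 1) (\<lambda>(t, y). bulk t y + flux t y)"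
      unfolding split_beta by (intro continuous_intros cont)
  qed auto
  also have "integral (cbox 0 1) (\<lambda>y. bulk t y + flux t y) = integral {0..1} (bulk t) + integral {0..1} (flux t)"
    unfolding interval_cbox[symmetric]
    by (intro Henstock_Kurzweil_Integration.integral_add integrable_continuous_interval cont_y)
  also have "integral {0..1} (bulk t) = flank_integral (burgers_pairing \<phi> t) h c (h * t)"
    by (simp add: bulk_def flank_integral_def X_def)
  also have "integral {0..1} (flux t) = h\<^sup>2 / 2 * \<phi> (t, h * t)"
    using integral_by_parts_cont_diff[of t c "h * t - c"] by (simp add: flux_def X_def)
  finally show ?thesis by (simp add: flank_integral_def X_def)
qed

lemma continuous_on_flank_integral_burgers_pairing:
  "continuous_on UNIV (\<lambda>t. flank_integral (burgers_pairing \<phi> t) h c (h * t))"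
proof -
  note [continuous_intros] = continuous_on_cont_diff
  have "continuous_on UNIV (\<lambda>t. integral (cbox 0 1) (\<lambda>y. burgers_pairing \<phi> t (c + y * (h * t - c)) (h * y)))"
    unfolding burgers_pairing_def
    by (intro integral_continuous_on_param) (auto simp: split_beta intro!: continuous_intros)
  then show ?thesis
    by (auto simp: flank_integral_def intro!: continuous_intros)
qed

lemma integral_tent_burgers_pairing:
  assumes "\<bar>p\<bar> < b"
  shows "(LBINT x. burgers_pairing \<phi> t x (tent b h p x))
    = flank_integral (burgers_pairing \<phi> t) h (-b) p - flank_integral (burgers_pairing \<phi> t) h b p"
proof (rule integral_tent[OF assms])
  show "continuous_on UNIV (\<lambda>x. burgers_pairing \<phi> t x (tent b h p x))"
    unfolding burgers_pairing_def by (intro continuous_intros continuous_on_cont_diff) simp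
qed (simp add: burgers_pairing_def)

end

lemma test_function_eq_0:
  assumes "\<phi> \<in> test_functions \<Omega>" and "p \<notin> \<Omega>"
  shows "\<phi> p = 0"
  using assms closure_subset[of "{p. \<phi> p \<noteq> 0}"] by (auto simp: test_functions_def)

lemma set_integral_Ioo_FTC:
  fixes f F :: "real \<Rightarrow> 'a::euclidean_space"
  assumes "a \<le> b" and "continuous_on {a..b} f"
    and "\<And>x. a \<le> x \<Longrightarrow> x \<le> b \<Longrightarrow> (F has_vector_derivative f x) (at x within {a..b})"
  shows "(LBINT x:{a<..<b}. f x) = F b - F a"
  using interval_integral_Ioo[of "ereal a" "ereal b" f] interval_integral_FTC_finite[of a b f F] assms
  by simp

lemma burgers_distributional_tent:
  assumes h: "0 \<le> h" and T: "0 \<le> T" and b: "h * T < b"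
  shows "burgers_distributional T (\<lambda>t. tent b h (h * t))"
  unfolding burgers_distributional_def burgers_pairing_def[symmetric]
proof
  fix \<phi> assume test: "\<phi> \<in> test_functions ({0<..<T} \<times> UNIV)"
  then have \<phi>: "k_times_cont_diff (Suc 0) \<phi>" unfolding test_functions_def by blast
  define moment where "moment t = flank_integral (\<lambda>x v. v * \<phi> (t, x)) h (-b) (h * t)
      - flank_integral (\<lambda>x v. v * \<phi> (t, x)) h b (h * t)" for t
  define rate where "rate t = flank_integral (burgers_pairing \<phi> t) h (-b) (h * t)
      - flank_integral (burgers_pairing \<phi> t) h b (h * t)" for t
  have moment_vanishes: "moment t = 0" if "t \<notin> {0<..<T}" for t
    using that by (simp add: moment_def flank_integral_def test_function_eq_0[OF test])
  have moment_deriv: "(moment has_real_derivative rate t) (at t)" for t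
    unfolding moment_def rate_def
    using DERIV_diff[OF flank_integral_conservation_law[OF \<phi>, of h "-b" t]
        flank_integral_conservation_law[OF \<phi>, of h b t]] by simp
  have "(LBINT t:{0<..<T}. (LBINT x. burgers_pairing \<phi> t x (tent b h (h * t) x))) = (LBINT t:{0<..<T}. rate t)"
  proof (intro set_lebesgue_integral_cong allI impI)
    fix t assume t: "t \<in> {0<..<T}"
    then have "h * t \<le> h * T" "0 \<le> h * t" using h by (auto intro: mult_left_mono)
    then show "(LBINT x. burgers_pairing \<phi> t x (tent b h (h * t) x)) = rate t"
      unfolding rate_def using b by (intro integral_tent_burgers_pairing \<phi>) auto
  qed auto
  also have "\<dots> = moment T - moment 0"
  proof (rule set_integral_Ioo_FTC[OF T])
    show "continuous_on {0..T} rate"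
      unfolding rate_def by (intro continuous_on_diff
          continuous_on_subset[OF continuous_on_flank_integral_burgers_pairing[OF \<phi>]]) auto
    show "(moment has_vector_derivative rate t) (at t within {0..T})" for t
      using moment_deriv
      by (simp add: has_real_derivative_iff_has_vector_derivative has_vector_derivative_at_within)
  qed
  also have "\<dots> = 0" by (simp add: moment_vanishes)
  finally show "(LBINT t:{0<..<T}. (LBINT x. burgers_pairing \<phi> t x (tent b h (h * t) x))) = 0" .
qed

lemma burgers_solution_tent:
  assumes s: "s < 3 / 2" and h: "0 \<le> h" and T: "0 \<le> T" and b: "h * T < b"
  shows "burgers_solution s T (tent b h 0) (\<lambda>t. tent b h (h * t))"
proof -
  have "continuous_into_sobolev s {0..T} (\<lambda>t. tent b h (h * t))"
    using s h b by (rule continuous_into_sobolev_tent)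
      (use h in \<open>auto intro!: continuous_intros mult_left_mono simp: abs_mult\<close>)
  with burgers_distributional_tent[OF h T b] show ?thesis
    by (simp add: burgers_solution_def)
qed

lemma small_tent_with_large_skewing:
  assumes s: "1 \<le> s" "s < 3 / 2" and \<tau>: "0 < \<tau>" and \<epsilon>: "0 < \<epsilon>"
  obtains b h p where "0 < h" and "0 < p" and "p < b" and "b / h = \<tau>"
    and "sobolev_norm s (tent b h 0) < \<epsilon>" and "K \<le> sobolev_norm s (tent b h p)"
proof -
  define m where "m = 1 / \<tau>"
  have m: "0 < m" using \<tau> by (simp add: m_def)
  have "\<forall>\<^sub>F b in at_right 0. sobolev_norm s (tent b (m * b) 0) < \<epsilon>"
    using m \<epsilon> by (intro order_tendstoD[OF sobolev_norm_narrow_tent_tendsto_0[OF s(2)]]) simp_all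
  then obtain b where b: "0 < b" and small: "sobolev_norm s (tent b (m * b) 0) < \<epsilon>"
    unfolding eventually_at_right_field by (metis dense)
  have "\<forall>\<^sub>F p in at_left b. K \<le> sobolev_norm s (tent b (m * b) p) \<and> p \<in> {0<..<b}"
    using sobolev_norm_tent_at_top[OF s b, of "m * b"] m b
    by (intro eventually_conj eventually_at_left_real) (auto simp: filterlim_at_top)
  then obtain p where "K \<le> sobolev_norm s (tent b (m * b) p)" and "0 < p" "p < b"
    by (auto dest: eventually_happens)
  moreover have "b / (m * b) = \<tau>" using b by (simp add: m_def)
  ultimately show thesis using small m b by (intro that) simp_all
qed

theorem theorem1p1:
  fixes s \<delta> :: real
  assumes "1 \<le> s" and "s < 3 / 2" and "\<delta> > 0"
  shows "\<exists>u0 T0 u.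
           u0 \<in> sobolev_space s \<and> sobolev_norm s u0 \<le> \<delta> \<and>
           0 < T0 \<and> T0 < \<delta> \<and>
           burgers_solution s T0 u0 u \<and>
           sobolev_norm s (u T0) \<ge> 1 / \<delta>"
proof -
  obtain b h p where h: "0 < h" and p: "0 < p" "p < b" and lifespan: "b / h = \<delta>"
    and small: "sobolev_norm s (tent b h 0) < \<delta>" and large: "1 / \<delta> \<le> sobolev_norm s (tent b h p)"
    by (rule small_tent_with_large_skewing[OF assms(1-3) assms(3)]) (rule that)
  define T where "T = p / h"
  have hT: "h * T = p" using h by (simp add: T_def)
  have T: "0 < T" "T < \<delta>"
    using p h by (simp_all add: T_def divide_strict_right_mono flip: lifespan)
  have solution: "burgers_solution s T (tent b h 0) (\<lambda>t. tent b h (h * t))"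
    using assms(2) h T p hT by (intro burgers_solution_tent) auto
  then have "tent b h 0 \<in> sobolev_space s"
    using T by (force simp: burgers_solution_def continuous_into_sobolev_def)
  with small large T solution show ?thesis
    by (intro exI[of _ "tent b h 0"] exI[of _ T] exI[of _ "\<lambda>t. tent b h (h * t)"]) (simp add: hT)
qed

end
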